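(* Let $\mathcal H$ be a complex Hilbert space, $\psi$ a bounded normal operator on $\mathcal H$ (i.e. $\psi\psi^*=\psi^*\psi$), $s\in\mathcal H$, and $\Psi=(\psi,s)$ the corresponding evolution. Then the following statements are equivalent: (i) $\Psi$ is stable; (ii) $\Psi$ is mean ergodic. In this case, the averages $\overline s^{(t)}=\frac1t\sum_{m=1}^t\psi^m s$ converge to the orthogonal projection of $s$ onto the eigenspace $E_1=\{x\in\mathcal H\mid\psi x=x\}$.
   Context: An evolution $\Psi=(\psi,s)$ consists of a linear operator $\psi$ and a vector $s$, and is identified with the sequence $(\psi^t s)_{t\ge0}$. $\Psi$ is stable if there is a real $c$ with $\|\psi^t s\|\le c\|s\|$ for all $t\ge0$. $\Psi$ is mean ergodic if the averages $\frac1t\sum_{m=1}^t\psi^m s$ converge in norm as $t\to\infty$. *)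

theory Defs
  imports "HOL-Analysis.Analysis"
begin

section \<open>Complex Hilbert spaces\<close>

text \<open>HOL-Analysis only provides real inner product spaces. The classes below add the complex
  structure; the inner product is antilinear in its first argument, and the metric, topology and
  real scalar multiplication are the library's.\<close>

class scaleC = scaleR +
  fixes scaleC :: "complex \<Rightarrow> 'a \<Rightarrow> 'a" (infixr "*\<^sub>C" 75)

class complex_vector = real_vector + scaleC +
  assumes scaleC_add_right: "a *\<^sub>C (x + y) = a *\<^sub>C x + a *\<^sub>C y"
    and scaleC_add_left: "(a + b) *\<^sub>C x = a *\<^sub>C x + b *\<^sub>C x"
    and scaleC_scaleC: "a *\<^sub>C b *\<^sub>C x = (a * b) *\<^sub>C x"
    and scaleC_one: "1 *\<^sub>C x = x"
    and scaleR_scaleC: "r *\<^sub>R x = complex_of_real r *\<^sub>C x"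

class complex_inner = complex_vector + real_normed_vector +
  fixes cinner :: "'a \<Rightarrow> 'a \<Rightarrow> complex"
  assumes cinner_commute: "cinner x y = cnj (cinner y x)"
    and cinner_add_left: "cinner (x + y) z = cinner x z + cinner y z"
    and cinner_scaleC_left: "cinner (a *\<^sub>C x) y = cnj a * cinner x y"
    and cinner_ge_zero: "0 \<le> Re (cinner x x)"
    and cinner_eq_zero_iff: "cinner x x = 0 \<longleftrightarrow> x = 0"
    and norm_eq_sqrt_cinner: "norm x = sqrt (Re (cinner x x))"

class chilbert_space = complex_inner + complete_space

instantiation complex :: chilbert_space
begin

definition scaleC_complex :: "complex \<Rightarrow> complex \<Rightarrow> complex"
  where "scaleC_complex a x = a * x"

definition cinner_complex :: "complex \<Rightarrow> complex \<Rightarrow> complex"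
  where "cinner_complex x y = cnj x * y"

instance
  by standard
    (auto simp: scaleC_complex_def cinner_complex_def algebra_simps scaleR_conv_of_real
      cmod_def power2_eq_square)

end

lemma cinner_add_right: "cinner x (y + z) = cinner x y + cinner x z"
  for x :: "'a::complex_inner"
  by (metis cinner_add_left cinner_commute complex_cnj_add)

lemma cinner_scaleC_right: "cinner x (a *\<^sub>C y) = a * cinner x y"
  for x :: "'a::complex_inner"
  by (metis cinner_scaleC_left cinner_commute complex_cnj_mult complex_cnj_cnj)

lemma minus_scaleC: "- x = (-1) *\<^sub>C x" for x :: "'a::complex_inner"
  using scaleR_scaleC[of "-1" x] by simp

lemma cinner_diff_left: "cinner (x - y) z = cinner x z - cinner y z"
  for x :: "'a::complex_inner"
  by (metis add_diff_cancel cinner_add_left diff_add_cancel)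

lemma cinner_diff_right: "cinner x (y - z) = cinner x y - cinner x z"
  for x :: "'a::complex_inner"
  by (metis add_diff_cancel cinner_add_right diff_add_cancel)

lemma cinner_zero_left [simp]: "cinner 0 x = 0" for x :: "'a::complex_inner"
  using cinner_diff_left[of 0 0 x] by simp

lemma cinner_zero_right [simp]: "cinner x 0 = 0" for x :: "'a::complex_inner"
  using cinner_diff_right[of x 0 0] by simp

lemma cinner_self: "cinner x x = complex_of_real ((norm x)\<^sup>2)" for x :: "'a::complex_inner"
proof -
  have "Im (cinner x x) = 0"
    by (metis cinner_commute complex_cnj_cancel_iff Reals_cnj_iff complex_is_Real_iff)
  moreover have "Re (cinner x x) = (norm x)\<^sup>2"
    using cinner_ge_zero[of x] norm_eq_sqrt_cinner[of x] by simp
  ultimately show ?thesis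
    by (simp add: complex_eq_iff)
qed

lemma norm_sq_cinner: "(norm x)\<^sup>2 = Re (cinner x x)" for x :: "'a::complex_inner"
  by (simp add: cinner_self)

lemma cinner_extensionality:
  fixes x y :: "'a::complex_inner"
  assumes "\<And>z. cinner x z = cinner y z"
  shows "x = y"
  using assms[of "x - y"] cinner_eq_zero_iff[of "x - y"] by (simp add: cinner_diff_left)

lemma parallelogram_law:
  fixes x y :: "'a::complex_inner"
  shows "(norm (x + y))\<^sup>2 + (norm (x - y))\<^sup>2 = 2 * (norm x)\<^sup>2 + 2 * (norm y)\<^sup>2"
  by (simp add: norm_sq_cinner cinner_add_left cinner_add_right cinner_diff_left cinner_diff_right)

lemma norm_sq_minus_component:
  fixes x z :: "'a::complex_inner"
  assumes "x \<noteq> 0"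
  shows "(norm (z - (cinner x z / cinner x x) *\<^sub>C x))\<^sup>2
    = (norm z)\<^sup>2 - (cmod (cinner x z))\<^sup>2 / (norm x)\<^sup>2"
proof -
  define a where "a = cinner x z"
  define n where "n = (norm x)\<^sup>2"
  have n: "n \<noteq> 0" "cinner x x = complex_of_real n"
    using assms by (auto simp: n_def cinner_self)
  have za: "cinner z x = cnj a"
    unfolding a_def by (rule cinner_commute)
  define b where "b = a / of_real n"
  have bn: "b * of_real n = a"
    using n by (simp add: b_def)
  have "cinner (z - b *\<^sub>C x) (z - b *\<^sub>C x)
    = cinner z z - b * cnj a - cnj b * a + cnj b * (b * of_real n)"
    by (simp add: cinner_diff_left cinner_diff_right cinner_scaleC_left cinner_scaleC_right
        za n a_def[symmetric] algebra_simps)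
  also have "\<dots> = cinner z z - a * cnj a / of_real n"
    unfolding bn by (simp add: b_def)
  also have "\<dots> = complex_of_real ((norm z)\<^sup>2 - (cmod a)\<^sup>2 / n)"
    by (simp add: cinner_self complex_norm_square[symmetric])
  finally have "Re (cinner (z - b *\<^sub>C x) (z - b *\<^sub>C x)) = (norm z)\<^sup>2 - (cmod a)\<^sup>2 / n"
    by simp
  then show ?thesis
    by (simp only: norm_sq_cinner[of "z - _"] b_def n(2) a_def n_def)
qed

lemma Cauchy_Schwarz_cinner:
  fixes x y :: "'a::complex_inner"
  shows "cmod (cinner x y) \<le> norm x * norm y"
proof (cases "x = 0")
  case False
  have "0 \<le> (norm y)\<^sup>2 - (cmod (cinner x y))\<^sup>2 / (norm x)\<^sup>2"
    unfolding norm_sq_minus_component[OF False, symmetric] by simp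
  then have "(cmod (cinner x y))\<^sup>2 \<le> (norm x * norm y)\<^sup>2"
    using False by (simp add: field_simps power_mult_distrib)
  then show ?thesis
    by (rule power2_le_imp_le) simp
qed simp

lemma bounded_bilinear_cinner:
  "bounded_bilinear (cinner :: 'a \<Rightarrow> 'a::complex_inner \<Rightarrow> complex)"
proof
  show "\<exists>K. \<forall>a b. norm (cinner (a::'a) b) \<le> norm a * norm b * K"
    using Cauchy_Schwarz_cinner by (intro exI[of _ 1]) auto
qed (simp_all add: cinner_add_left cinner_add_right scaleR_scaleC cinner_scaleC_left
    cinner_scaleC_right scaleC_complex_def)

section \<open>Orthogonal projections\<close>

definition orthogonal_projection :: "'a::complex_inner set \<Rightarrow> 'a \<Rightarrow> 'a"
  where "orthogonal_projection M x = (THE p. p \<in> M \<and> (\<forall>y\<in>M. cinner y (x - p) = 0))"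

definition csubspace :: "'a::complex_vector set \<Rightarrow> bool"
  where "csubspace M \<longleftrightarrow>
    0 \<in> M \<and> (\<forall>x\<in>M. \<forall>y\<in>M. x + y \<in> M) \<and> (\<forall>c. \<forall>x\<in>M. c *\<^sub>C x \<in> M)"

lemma csubspace_diff:
  fixes M :: "'a::complex_inner set"
  assumes "csubspace M" "x \<in> M" "y \<in> M"
  shows "x - y \<in> M"
proof -
  have "x + (-1) *\<^sub>C y \<in> M"
    using assms by (auto simp: csubspace_def)
  then show ?thesis
    by (simp flip: minus_scaleC)
qed

lemma orthogonal_projection_eqI:
  fixes M :: "'a::complex_inner set"
  assumes "csubspace M" "p \<in> M" "\<And>y. y \<in> M \<Longrightarrow> cinner y (x - p) = 0"
  shows "orthogonal_projection M x = p"
  unfolding orthogonal_projection_def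
proof (rule the_equality)
  fix q assume q: "q \<in> M \<and> (\<forall>y\<in>M. cinner y (x - q) = 0)"
  have "q - p \<in> M"
    using assms q by (simp add: csubspace_diff)
  then have "cinner (q - p) ((x - p) - (x - q)) = 0"
    using assms(3) q by (simp only: cinner_diff_right) simp
  then show "q = p"
    by (simp add: cinner_eq_zero_iff)
qed (use assms in auto)

lemma nearest_point_exists:
  fixes M :: "'a::chilbert_space set"
  assumes "csubspace M" "closed M"
  obtains p where "p \<in> M" "\<And>y. y \<in> M \<Longrightarrow> norm (x - p) \<le> norm (x - y)"
proof -
  define d where "d = infdist x M"
  have ne: "M \<noteq> {}"
    using assms by (auto simp: csubspace_def)
  have d0: "d \<ge> 0"
    by (simp add: d_def infdist_nonneg)
  have dle: "d \<le> norm (x - y)" if "y \<in> M" for y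
    using that by (metis d_def infdist_le dist_norm)
  define S where "S n = M \<inter> cball x (d + 1 / real (Suc n))" for n
  have "\<exists>p. \<forall>n. p \<in> S n"
  proof (rule decreasing_closed_nest[of S])
    show "closed (S n)" for n
      using assms by (auto simp: S_def)
    show "S n \<noteq> {}" for n
    proof -
      have "\<exists>y\<in>M. dist x y < d + 1 / real (Suc n)"
      proof (rule ccontr)
        assume "\<not> ?thesis"
        then have "d + 1 / real (Suc n) \<le> infdist x M"
          unfolding infdist_notempty[OF ne] by (intro cINF_greatest[OF ne]) force
        then show False
          by (simp add: d_def)
      qed
      then show ?thesis
        by (force simp: S_def)
    qed
    show "S n \<subseteq> S m" if "m \<le> n" for m n
    proof -
      have "1 / real (Suc n) \<le> 1 / real (Suc m)"
        using that by (simp add: frac_le)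
      then show ?thesis
        by (auto simp: S_def)
    qed
    fix e :: real assume e: "e > 0"
    define h where "h n = 4 * (d + 1 / real (Suc n))\<^sup>2 - 4 * d\<^sup>2" for n
    have "h \<longlonglongrightarrow> 4 * (d + 0)\<^sup>2 - 4 * d\<^sup>2"
      unfolding h_def by (intro tendsto_intros LIMSEQ_inverse_real_of_nat[unfolded inverse_eq_divide])
    then have "\<forall>\<^sub>F n in sequentially. h n < e\<^sup>2"
      using e by (intro order_tendstoD(2)) auto
    then obtain n where n: "h n < e\<^sup>2"
      by (meson eventually_happens' sequentially_bot)
    have "dist y z < e" if y: "y \<in> S n" and z: "z \<in> S n" for y z
    proof -
      define r where "r = d + 1 / real (Suc n)"
      have yz: "norm (x - y) \<le> r" "norm (x - z) \<le> r" "y \<in> M" "z \<in> M"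
        using y z by (auto simp: S_def r_def dist_norm)
      have "complex_of_real (1/2) *\<^sub>C (y + z) \<in> M"
        using yz assms unfolding csubspace_def by blast
      then have "d \<le> norm (x - (1/2) *\<^sub>R (y + z))"
        using dle by (simp only: scaleR_scaleC)
      moreover have "(x - y) + (x - z) = 2 *\<^sub>R (x - (1/2) *\<^sub>R (y + z))"
        by (simp add: algebra_simps scaleR_2)
      ultimately have "2 * d \<le> norm ((x - y) + (x - z))"
        by simp
      then have "(2 * d)\<^sup>2 \<le> (norm ((x - y) + (x - z)))\<^sup>2"
        using d0 by (intro power_mono) auto
      moreover have "(norm (x - y))\<^sup>2 \<le> r\<^sup>2" "(norm (x - z))\<^sup>2 \<le> r\<^sup>2"
        using yz by (auto intro: power_mono)
      moreover have "norm ((x - y) - (x - z)) = dist y z"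
        by (simp add: dist_norm norm_minus_commute)
      ultimately have "(dist y z)\<^sup>2 \<le> 4 * r\<^sup>2 - 4 * d\<^sup>2"
        using parallelogram_law[of "x - y" "x - z"] by (simp add: power_mult_distrib)
      then have "(dist y z)\<^sup>2 < e\<^sup>2"
        using n by (simp add: h_def r_def)
      then show ?thesis
        using e by (simp add: power_less_imp_less_base)
    qed
    then show "\<exists>n. \<forall>y\<in>S n. \<forall>z\<in>S n. dist y z < e"
      by blast
  qed blast
  then obtain p where p: "\<And>n. p \<in> S n"
    by blast
  have "norm (x - p) \<le> d"
  proof (rule LIMSEQ_le_const)
    show "(\<lambda>n. d + 1 / real (Suc n)) \<longlonglongrightarrow> d"
      using tendsto_add[OF tendsto_const LIMSEQ_inverse_real_of_nat, of d]
      by (simp add: inverse_eq_divide)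
    show "\<exists>N. \<forall>n\<ge>N. norm (x - p) \<le> d + 1 / real (Suc n)"
      using p by (auto simp: S_def dist_norm)
  qed
  then show ?thesis
    using that[of p] p dle by (force simp: S_def)
qed

lemma orthogonal_projection_works:
  fixes M :: "'a::chilbert_space set"
  assumes M: "csubspace M" "closed M"
  shows "orthogonal_projection M x \<in> M"
    and "y \<in> M \<Longrightarrow> cinner y (x - orthogonal_projection M x) = 0"
proof -
  obtain p where p: "p \<in> M" "\<And>y. y \<in> M \<Longrightarrow> norm (x - p) \<le> norm (x - y)"
    using nearest_point_exists[OF M] by blast
  have orth: "cinner y (x - p) = 0" if y: "y \<in> M" for y
  proof (cases "y = 0")
    case False
    define c where "c = cinner y (x - p) / cinner y y"
    have "p + c *\<^sub>C y \<in> M"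
      using M p y by (auto simp: csubspace_def)
    then have "norm (x - p) \<le> norm ((x - p) - c *\<^sub>C y)"
      using p(2) by (metis diff_diff_eq)
    then have "(norm (x - p))\<^sup>2 \<le> (norm ((x - p) - c *\<^sub>C y))\<^sup>2"
      by (simp add: power_mono)
    then have "(cmod (cinner y (x - p)))\<^sup>2 / (norm y)\<^sup>2 \<le> 0"
      unfolding c_def norm_sq_minus_component[OF False] by simp
    then show ?thesis
      using False by (simp add: divide_le_0_iff)
  qed simp
  then have "orthogonal_projection M x = p"
    using orthogonal_projection_eqI[OF M(1) p(1)] by blast
  then show "orthogonal_projection M x \<in> M"
    and "y \<in> M \<Longrightarrow> cinner y (x - orthogonal_projection M x) = 0"
    using p orth by auto
qed

section \<open>Bounded normal operators\<close>

definition bounded_clinear :: "('a::complex_inner \<Rightarrow> 'b::complex_inner) \<Rightarrow> bool"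
  where "bounded_clinear f \<longleftrightarrow> bounded_linear f \<and> (\<forall>c x. f (c *\<^sub>C x) = c *\<^sub>C f x)"

definition cadjoint :: "('a::chilbert_space \<Rightarrow> 'a) \<Rightarrow> 'a \<Rightarrow> 'a"
  where "cadjoint f = (THE g. \<forall>x y. cinner (g x) y = cinner x (f y))"

definition normal_operator :: "('a::chilbert_space \<Rightarrow> 'a) \<Rightarrow> bool"
  where "normal_operator f \<longleftrightarrow> f \<circ> cadjoint f = cadjoint f \<circ> f"

lemma Riesz_representation:
  fixes L :: "'a::chilbert_space \<Rightarrow> complex"
  assumes L: "bounded_clinear L"
  obtains u where "\<And>x. L x = cinner u x"
proof (cases "\<forall>x. L x = 0")
  case True
  then show ?thesis
    using that[of 0] by simp
next
  case False
  then obtain z where z: "L z \<noteq> 0"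
    by blast
  interpret bounded_linear L
    using L by (simp add: bounded_clinear_def)
  have Lc: "L (c *\<^sub>C x) = c * L x" for c x
    using L by (simp add: bounded_clinear_def scaleC_complex_def)
  define M where "M = {x. L x = 0}"
  have M: "csubspace M" "closed M"
    by (auto simp: M_def csubspace_def add Lc zero
        intro!: closed_Collect_eq continuous_on continuous_intros)
  define w where "w = z - orthogonal_projection M z"
  have w: "L w = L z" "\<And>y. y \<in> M \<Longrightarrow> cinner w y = 0"
    using orthogonal_projection_works[OF M]
    by (auto simp: w_def diff M_def intro: cinner_commute[THEN trans])
  then have w0: "w \<noteq> 0"
    using z zero by auto
  have "L x = cinner (cnj (L w / cinner w w) *\<^sub>C w) x" for x
  proof -
    have "x - (L x / L w) *\<^sub>C w \<in> M"
      using z w by (simp add: M_def diff Lc)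
    then have "cinner w x = L x / L w * cinner w w"
      using w(2) by (force simp: cinner_diff_right cinner_scaleC_right)
    then show ?thesis
      using w z w0 by (simp add: cinner_scaleC_left cinner_eq_zero_iff)
  qed
  then show ?thesis
    using that by blast
qed

lemma cadjoint_works:
  fixes f :: "'a::chilbert_space \<Rightarrow> 'a"
  assumes f: "bounded_clinear f"
  shows "cinner (cadjoint f x) y = cinner x (f y)"
proof -
  have "\<exists>u. \<forall>y. cinner x (f y) = cinner u y" for x
  proof -
    have "bounded_linear (\<lambda>y. cinner x (f y))"
      using f bounded_linear_compose[OF bounded_bilinear.bounded_linear_right
          [OF bounded_bilinear_cinner]]
      by (auto simp: bounded_clinear_def)
    then have "bounded_clinear (\<lambda>y. cinner x (f y))"
      using f by (simp add: bounded_clinear_def cinner_scaleC_right scaleC_complex_def)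
    then show ?thesis
      using Riesz_representation by blast
  qed
  then obtain g where g: "\<forall>x y. cinner (g x) y = cinner x (f y)"
    by metis
  have "cadjoint f = g"
    unfolding cadjoint_def
  proof (rule the_equality[where P = "\<lambda>g. \<forall>x y. cinner (g x) y = cinner x (f y)", OF g])
    fix h assume "\<forall>x y. cinner (h x) y = cinner x (f y)"
    then show "h = g"
      using g by (metis cinner_extensionality ext)
  qed
  then show ?thesis
    using g by simp
qed

section \<open>Evolutions\<close>

type_synonym 'a evolution = "('a \<Rightarrow> 'a) \<times> 'a"

definition evolution_seq :: "'a evolution \<Rightarrow> nat \<Rightarrow> 'a"
  where "evolution_seq \<Psi> t = (fst \<Psi> ^^ t) (snd \<Psi>)"

definition stable_evolution :: "'a::real_normed_vector evolution \<Rightarrow> bool"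
  where "stable_evolution \<Psi> \<longleftrightarrow> (\<exists>c::real. \<forall>t. norm (evolution_seq \<Psi> t) \<le> c * norm (snd \<Psi>))"

text \<open>The value at \<open>t = 0\<close> is the junk value 0; only the limit \<open>t \<rightarrow> \<infinity>\<close> matters.\<close>

definition evolution_average :: "'a::real_normed_vector evolution \<Rightarrow> nat \<Rightarrow> 'a"
  where "evolution_average \<Psi> t = (1 / real t) *\<^sub>R (\<Sum>m=1..t. evolution_seq \<Psi> m)"

definition mean_ergodic :: "'a::real_normed_vector evolution \<Rightarrow> bool"
  where "mean_ergodic \<Psi> \<longleftrightarrow> convergent (evolution_average \<Psi>)"

end

theory Submission
  imports Defs
begin

text \<open>Normality makes the norms \<open>\<parallel>\<psi>\<^sup>t s\<parallel>\<close> a log-convex sequence. A log-convex sequence that grows at most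
  linearly is nonincreasing, and both stability and mean ergodicity imply linear growth: so mean
  ergodicity implies stability, and the stable vectors are exactly those with
  \<open>\<parallel>\<psi>\<^sup>t x\<parallel> \<le> \<parallel>x\<parallel>\<close> for all \<open>t\<close>. These form a closed invariant subspace \<open>K\<close> on which \<open>\<psi>\<close> is a
  contraction, and von Neumann's argument for the mean ergodic theorem applies there: the
  component of \<open>s\<close> orthogonal to \<open>(\<psi> - 1) K\<close> is fixed by \<open>\<psi>\<close>, and the averages vanish in the limit
  on the closure of \<open>(\<psi> - 1) K\<close>. By normality a fixed vector of \<open>\<psi>\<close> is fixed by the adjoint too, so it is
  orthogonal to \<open>(\<psi> - 1) K\<close>, which identifies the fixed component as the projection onto \<open>E\<^sub>1\<close>.\<close>

section \<open>Log-convex sequences\<close>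

lemma log_convex_linear_growth_imp_decseq:
  fixes a :: "nat \<Rightarrow> real"
  assumes nonneg: "\<And>n. 0 \<le> a n"
    and log_convex: "\<And>n. (a (Suc n))\<^sup>2 \<le> a n * a (Suc (Suc n))"
    and growth: "\<And>n. a n \<le> C * (real n + 1)"
  shows "decseq a"
proof (rule decseq_SucI, rule ccontr)
  \<comment> \<open>One strict increase yields a ratio \<open>r > 1\<close>; log-convexity keeps all
    later ratios at least \<open>r\<close>, and geometric growth contradicts
    \<open>growth\<close>.\<close>
  fix k assume "\<not> a (Suc k) \<le> a k"
  then have less: "a k < a (Suc k)" by simp
  have "a k \<noteq> 0"
  proof
    assume "a k = 0"
    with log_convex[of k] less show False by simp
  qed
  with nonneg[of k] have pos: "0 < a k" by simp
  define r where "r = a (Suc k) / a k"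
  have r: "1 < r" using pos less by (simp add: r_def)
  \<comment> \<open>Positivity is carried through the induction because the factor
    \<open>a (k + n)\<close> gets cancelled.\<close>
  have step: "0 < a (k + n) \<and> r * a (k + n) \<le> a (Suc (k + n))" for n
  proof (induction n)
    case 0
    show ?case using pos by (simp add: r_def)
  next
    case (Suc n)
    let ?x = "a (k + n)" and ?y = "a (Suc (k + n))" and ?z = "a (Suc (Suc (k + n)))"
    have x: "0 < ?x" "r * ?x \<le> ?y" using Suc.IH by auto
    have y: "0 < ?y" using x r by (smt (verit) mult_pos_pos)
    have "?x * (r * ?y) \<le> ?y * ?y"
      using mult_right_mono[OF x(2), of ?y] y by (simp add: mult_ac)
    also have "\<dots> \<le> ?x * ?z"
      using log_convex[of "k + n"] by (simp add: power2_eq_square)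
    finally have "r * ?y \<le> ?z" using x(1) by simp
    with y show ?case by simp
  qed
  have geom: "r ^ n * a k \<le> a (k + n)" for n
  proof (induction n)
    case (Suc n)
    have "r ^ Suc n * a k \<le> r * a (k + n)"
      using mult_left_mono[OF Suc.IH, of r] r by (simp add: mult_ac)
    also have "\<dots> \<le> a (k + Suc n)" using step[of n] by simp
    finally show ?case .
  qed simp
  \<comment> \<open>The linear bound divided by \<open>r ^ n\<close>, split into two null
    sequences.\<close>
  have le: "a k \<le> C * (real k + 1) * (1 / r) ^ n + C * (real n * (1 / r) ^ n)" for n
  proof -
    have "r ^ n * a k \<le> C * (real (k + n) + 1)"
      using geom[of n] growth[of "k + n"] by linarith
    then have "a k \<le> C * (real (k + n) + 1) / r ^ n"
      using r by (simp add: field_simps)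
    then show ?thesis using r by (simp add: field_simps)
  qed
  have "(\<lambda>n. (1 / r) ^ n) \<longlonglongrightarrow> 0"
    using r by (intro LIMSEQ_realpow_zero) auto
  moreover have "(\<lambda>n. real n * (1 / r) ^ n) \<longlonglongrightarrow> 0"
    using r by (intro powser_times_n_limit_0) auto
  ultimately have "(\<lambda>n. C * (real k + 1) * (1 / r) ^ n + C * (real n * (1 / r) ^ n))
      \<longlonglongrightarrow> C * (real k + 1) * 0 + C * 0"
    by (intro tendsto_add tendsto_mult_left)
  then have "a k \<le> C * (real k + 1) * 0 + C * 0"
    using le by (intro LIMSEQ_le_const) auto
  with pos show False by simp
qed

section \<open>Scalar multiples and closures of complex subspaces\<close>

lemma norm_scaleC: "norm (c *\<^sub>C x) = cmod c * norm x" for x :: "'a::complex_inner"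
proof -
  have "cinner (c *\<^sub>C x) (c *\<^sub>C x) = (c * cnj c) * cinner x x"
    by (simp add: cinner_scaleC_left cinner_scaleC_right)
  also have "\<dots> = complex_of_real ((cmod c * norm x)\<^sup>2)"
    by (simp add: cinner_self power_mult_distrib flip: complex_norm_square)
  finally have "(norm (c *\<^sub>C x))\<^sup>2 = (cmod c * norm x)\<^sup>2"
    by (simp add: norm_sq_cinner)
  then show ?thesis by simp
qed

lemma closure_csubspace:
  fixes M :: "'a::complex_inner set"
  assumes "csubspace M"
  shows "csubspace (closure M)"
proof -
  have scale: "bounded_linear (\<lambda>x::'a. c *\<^sub>C x)" for c
  proof
    show "\<exists>K. \<forall>x::'a. norm (c *\<^sub>C x) \<le> norm x * K"
      by (intro exI[of _ "cmod c"]) (simp add: norm_scaleC)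
  qed (simp_all add: scaleC_add_right scaleR_scaleC scaleC_scaleC mult.commute)
  have "x + y \<in> closure M" if xy: "x \<in> closure M" "y \<in> closure M" for x y
  proof -
    obtain f g where "\<forall>n. f n \<in> M" "f \<longlonglongrightarrow> x" "\<forall>n. g n \<in> M" "g \<longlonglongrightarrow> y"
      using xy unfolding closure_sequential by blast
    then show ?thesis
      using assms unfolding closure_sequential csubspace_def
      by (intro exI[of _ "\<lambda>n. f n + g n"]) (auto intro: tendsto_add)
  qed
  moreover have "c *\<^sub>C x \<in> closure M" if x: "x \<in> closure M" for c x
  proof -
    obtain f where "\<forall>n. f n \<in> M" "f \<longlonglongrightarrow> x"
      using x unfolding closure_sequential by blast
    then show ?thesis
      using assms bounded_linear.tendsto[OF scale] unfolding closure_sequential csubspace_def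
      by (intro exI[of _ "\<lambda>n. c *\<^sub>C f n"]) auto
  qed
  moreover have "0 \<in> closure M"
    using assms closure_subset[of M] by (auto simp: csubspace_def)
  ultimately show ?thesis by (auto simp: csubspace_def)
qed

section \<open>Norms along the orbits of a normal operator\<close>

locale bounded_normal =
  fixes \<psi> :: "'a::chilbert_space \<Rightarrow> 'a"
  assumes bounded_clinear: "bounded_clinear \<psi>"
    and normal: "normal_operator \<psi>"
begin

sublocale bounded_linear \<psi>
  using bounded_clinear by (simp add: bounded_clinear_def)

lemma scaleC: "\<psi> (c *\<^sub>C x) = c *\<^sub>C \<psi> x"
  using bounded_clinear by (simp add: bounded_clinear_def)

lemma bounded_linear_funpow: "bounded_linear (\<psi> ^^ n)"
proof (induction n)
  case (Suc n)
  from bounded_linear_compose[OF bounded_linear_axioms this] show ?case by (simp add: o_def)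
qed (simp add: id_def bounded_linear_ident)

lemma funpow_scaleC: "(\<psi> ^^ n) (c *\<^sub>C x) = c *\<^sub>C (\<psi> ^^ n) x"
  by (induction n) (simp_all add: scaleC)

lemma funpow_fixed: "\<psi> x = x \<Longrightarrow> (\<psi> ^^ n) x = x"
  by (induction n) simp_all

lemmas cadjoint = cadjoint_works[OF bounded_clinear]

text \<open>Normality enters the argument only through this equality: it allows
  \<open>\<psi>\<close> and its adjoint to be swapped in the squared norm.\<close>

lemma norm_cadjoint: "norm (cadjoint \<psi> x) = norm (\<psi> x)"
proof -
  have "cinner (cadjoint \<psi> x) (cadjoint \<psi> x) = cinner x (\<psi> (cadjoint \<psi> x))"
    by (rule cadjoint)
  also have "\<dots> = cinner x (cadjoint \<psi> (\<psi> x))"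
    using normal by (metis normal_operator_def comp_apply)
  also have "\<dots> = cnj (cinner (\<psi> x) (\<psi> x))"
    by (metis cinner_commute cadjoint)
  finally have "(norm (cadjoint \<psi> x))\<^sup>2 = (norm (\<psi> x))\<^sup>2"
    by (simp add: norm_sq_cinner)
  then show ?thesis by simp
qed

text \<open>In the expanded square, both squared norms and the real part of the cross term, which is
  that of \<open>cinner x (\<psi> x)\<close>, equal the squared norm of \<open>x\<close>.\<close>

lemma cadjoint_fixed:
  assumes "\<psi> x = x"
  shows "cadjoint \<psi> x = x"
proof -
  have "(norm (cadjoint \<psi> x - x))\<^sup>2
      = (norm (cadjoint \<psi> x))\<^sup>2 + (norm x)\<^sup>2 - 2 * Re (cinner (cadjoint \<psi> x) x)"
    using arg_cong[OF cinner_commute, of Re x "cadjoint \<psi> x"]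
    by (simp add: norm_sq_cinner cinner_diff_left cinner_diff_right)
  also have "\<dots> = 0"
    by (simp add: norm_cadjoint cadjoint assms norm_sq_cinner)
  finally show ?thesis by simp
qed

text \<open>Cauchy-Schwarz for \<open>cadjoint \<psi> (\<psi> y)\<close> and \<open>y\<close>; by
  \<open>norm_cadjoint\<close> the former has the norm of \<open>\<psi> (\<psi> y)\<close>.\<close>

lemma norm_funpow_log_convex:
  "(norm ((\<psi> ^^ Suc n) x))\<^sup>2 \<le> norm ((\<psi> ^^ n) x) * norm ((\<psi> ^^ Suc (Suc n)) x)"
proof -
  define y where "y = (\<psi> ^^ n) x"
  have "(norm (\<psi> y))\<^sup>2 = Re (cinner (cadjoint \<psi> (\<psi> y)) y)"
    by (simp add: norm_sq_cinner cadjoint)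
  also have "\<dots> \<le> norm (cadjoint \<psi> (\<psi> y)) * norm y"
    using complex_Re_le_cmod Cauchy_Schwarz_cinner order_trans by blast
  finally show ?thesis
    by (simp add: norm_cadjoint y_def mult.commute)
qed

lemma linear_growth_imp_contractive:
  assumes "\<And>n. norm ((\<psi> ^^ n) x) \<le> C * (real n + 1)"
  shows "norm ((\<psi> ^^ n) x) \<le> norm x"
proof -
  have "decseq (\<lambda>n. norm ((\<psi> ^^ n) x))"
    using norm_funpow_log_convex assms
    by (intro log_convex_linear_growth_imp_decseq[where C = C]) auto
  then show ?thesis
    using decseqD[of _ 0 n] by fastforce
qed

section \<open>The subspace of stable vectors\<close>

definition stable_part :: "'a set"
  where "stable_part = {x. \<forall>n. norm ((\<psi> ^^ n) x) \<le> norm x}"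

text \<open>A constant bound is in particular a linear one. This gives membership when the natural
  bound is not the norm of the vector itself, as with \<open>norm x + norm y\<close> for
  \<open>x + y\<close>.\<close>

lemma bounded_orbit_imp_stable_part:
  assumes "\<And>n. norm ((\<psi> ^^ n) x) \<le> C"
  shows "x \<in> stable_part"
proof -
  have "0 \<le> C" using assms[of 0] norm_ge_zero order_trans by blast
  have "norm ((\<psi> ^^ n) x) \<le> C * (real n + 1)" for n
    using assms[of n] mult_left_mono[OF _ \<open>0 \<le> C\<close>, of 1 "real n + 1"] by simp
  then show ?thesis
    using linear_growth_imp_contractive by (auto simp: stable_part_def)
qed

lemma stable_evolution_iff: "stable_evolution (\<psi>, x) \<longleftrightarrow> x \<in> stable_part"
proof
  assume "stable_evolution (\<psi>, x)"
  then show "x \<in> stable_part"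
    using bounded_orbit_imp_stable_part by (auto simp: stable_evolution_def evolution_seq_def)
next
  assume "x \<in> stable_part"
  then show "stable_evolution (\<psi>, x)"
    by (auto simp: stable_evolution_def evolution_seq_def stable_part_def intro!: exI[of _ 1])
qed

text \<open>Convergent averages are bounded, so the partial sums \<open>S t\<close> grow at most
  linearly, and so do their successive differences, the orbit terms.\<close>

lemma mean_ergodic_imp_stable_part:
  assumes "mean_ergodic (\<psi>, x)"
  shows "x \<in> stable_part"
proof -
  define S where "S t = (\<Sum>m=1..t. (\<psi> ^^ m) x)" for t
  have "Bseq (evolution_average (\<psi>, x))"
    using assms by (simp add: mean_ergodic_def convergent_imp_Bseq)
  then obtain C where C: "0 < C" "\<And>t. norm (evolution_average (\<psi>, x) t) \<le> C"
    by (auto simp: Bseq_def)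
  have S: "norm (S t) \<le> C * real t" for t
  \<comment> \<open>At \<open>t = 0\<close> the average is a default value; the sum is empty
    there.\<close>
  proof (cases "t = 0")
    case False
    with C(2)[of t] show ?thesis
      by (simp add: evolution_average_def evolution_seq_def S_def field_simps)
  qed (simp add: S_def)
  \<comment> \<open>\<open>2 * C\<close> pays for two partial sums; \<open>norm x\<close> covers
    \<open>n = 0\<close>, where the orbit term is not a difference of such sums.\<close>
  have "norm ((\<psi> ^^ n) x) \<le> (2 * C + norm x) * (real n + 1)" for n
  proof (cases n)
    case 0
    then show ?thesis using C by simp
  next
    case (Suc k)
    have "(\<psi> ^^ n) x = S n - S k" by (simp add: S_def Suc)
    then have "norm ((\<psi> ^^ n) x) \<le> norm (S n) + norm (S k)"
      by (metis norm_triangle_ineq4)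
    also have "\<dots> \<le> C * real n + C * real n"
      using C Suc by (intro add_mono S order_trans[OF S[of k]] mult_left_mono) auto
    also have "\<dots> \<le> (2 * C + norm x) * (real n + 1)"
      using C by (simp add: algebra_simps)
    finally show ?thesis .
  qed
  then show ?thesis
    using linear_growth_imp_contractive by (auto simp: stable_part_def)
qed

lemma csubspace_stable_part: "csubspace stable_part"
proof -
  have "x + y \<in> stable_part" if "x \<in> stable_part" "y \<in> stable_part" for x y
  proof (rule bounded_orbit_imp_stable_part)
    fix n
    interpret pow: bounded_linear "\<psi> ^^ n" by (rule bounded_linear_funpow)
    show "norm ((\<psi> ^^ n) (x + y)) \<le> norm x + norm y"
      using that unfolding pow.add stable_part_def
      by (auto intro: norm_triangle_le add_mono)
  qed
  moreover have "c *\<^sub>C x \<in> stable_part" if "x \<in> stable_part" for c x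
    using that by (auto simp: stable_part_def funpow_scaleC norm_scaleC intro: mult_left_mono)
  moreover have "0 \<in> stable_part"
    by (rule bounded_orbit_imp_stable_part[of _ 0])
       (simp add: linear_simps(3)[OF bounded_linear_funpow])
  ultimately show ?thesis by (auto simp: csubspace_def)
qed

lemma closed_stable_part: "closed stable_part"
proof -
  have "continuous_on UNIV (\<psi> ^^ n)" for n
    using bounded_linear_funpow by (rule linear_continuous_on)
  then show ?thesis
    unfolding stable_part_def by (intro closed_Collect_all closed_Collect_le continuous_intros)
qed

lemma stable_part_invariant:
  assumes "x \<in> stable_part"
  shows "\<psi> x \<in> stable_part"
proof (rule bounded_orbit_imp_stable_part)
  fix n
  have "norm ((\<psi> ^^ Suc n) x) \<le> norm x"
    using assms unfolding stable_part_def by blast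
  then show "norm ((\<psi> ^^ n) (\<psi> x)) \<le> norm x"
    by (simp add: funpow_swap1)
qed

section \<open>Averages of coboundaries\<close>

lemma evolution_average_add:
  "evolution_average (\<psi>, x + y) t = evolution_average (\<psi>, x) t + evolution_average (\<psi>, y) t"
  by (simp add: evolution_average_def evolution_seq_def linear_simps(1)[OF bounded_linear_funpow]
      sum.distrib scaleR_add_right)

lemma norm_evolution_average_le:
  assumes "x \<in> stable_part"
  shows "norm (evolution_average (\<psi>, x) t) \<le> norm x"
proof (cases "t = 0")
  case False
  have "norm (\<Sum>m=1..t. (\<psi> ^^ m) x) \<le> real (card {1..t}) * norm x"
    using assms by (intro sum_norm_bound) (auto simp: stable_part_def)
  with False show ?thesis
    by (simp add: evolution_average_def evolution_seq_def field_simps)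
qed (simp add: evolution_average_def)

text \<open>The sum telescopes to a vector of norm at most \<open>2 * norm x\<close>; it starts at
  \<open>m = 1\<close>, so \<open>\<psi> x\<close> is subtracted rather than
  \<open>x\<close>.\<close>

lemma evolution_average_coboundary_tendsto:
  assumes "x \<in> stable_part"
  shows "evolution_average (\<psi>, \<psi> x - x) \<longlonglongrightarrow> 0"
proof (rule Lim_null_comparison)
  have "(\<Sum>m=1..t. (\<psi> ^^ m) (\<psi> x - x)) = (\<psi> ^^ Suc t) x - \<psi> x" for t
  proof (induction t)
    case (Suc t)
    have "(\<psi> ^^ Suc t) (\<psi> x - x) = (\<psi> ^^ Suc (Suc t)) x - (\<psi> ^^ Suc t) x"
      unfolding linear_simps(2)[OF bounded_linear_funpow]
      by (metis funpow_swap1 funpow.simps(2) comp_apply)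
    with Suc.IH show ?case by simp
  qed simp
  moreover have "norm ((\<psi> ^^ Suc t) x - \<psi> x) \<le> 2 * norm x" for t
  proof -
    have "norm ((\<psi> ^^ n) x) \<le> norm x" for n
      using assms by (simp add: stable_part_def)
    from this[of "Suc t"] this[of 1] show ?thesis
      using norm_triangle_ineq4[of "(\<psi> ^^ Suc t) x" "\<psi> x"] by simp
  qed
  ultimately have "norm (evolution_average (\<psi>, \<psi> x - x) t) \<le> 2 * norm x / real t" for t
    by (simp add: evolution_average_def evolution_seq_def divide_right_mono)
  then show "\<forall>\<^sub>F t in sequentially. norm (evolution_average (\<psi>, \<psi> x - x) t) \<le> 2 * norm x / real t"
    by simp
  show "(\<lambda>t. 2 * norm x / real t) \<longlonglongrightarrow> 0"
    by (rule lim_const_over_n)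
qed

text \<open>The closure is taken so that the orthogonal projection exists.\<close>

definition coboundaries :: "'a set"
  where "coboundaries = closure ((\<lambda>x. \<psi> x - x) ` stable_part)"

lemma csubspace_coboundaries: "csubspace coboundaries"
  unfolding coboundaries_def
proof (rule closure_csubspace)
  let ?B = "(\<lambda>x. \<psi> x - x) ` stable_part"
  have "0 \<in> ?B"
    using csubspace_stable_part by (intro image_eqI[of _ _ 0]) (simp_all add: csubspace_def zero)
  moreover have "(\<psi> x - x) + (\<psi> y - y) \<in> ?B" if "x \<in> stable_part" "y \<in> stable_part" for x y
    using that csubspace_stable_part
    by (intro image_eqI[of _ _ "x + y"]) (simp_all add: csubspace_def add)
  moreover have "c *\<^sub>C (\<psi> x - x) \<in> ?B" if "x \<in> stable_part" for c x
  proof (rule image_eqI)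
    show "c *\<^sub>C x \<in> stable_part"
      using that csubspace_stable_part by (simp add: csubspace_def)
    show "c *\<^sub>C (\<psi> x - x) = \<psi> (c *\<^sub>C x) - c *\<^sub>C x"
      using scaleC_add_right[of c "\<psi> x - x" x] by (simp add: scaleC)
  qed
  ultimately show "csubspace ?B"
    unfolding csubspace_def by blast
qed

lemma coboundaries_subset: "coboundaries \<subseteq> stable_part"
  unfolding coboundaries_def
  by (rule closure_minimal)
     (auto intro: csubspace_diff csubspace_stable_part stable_part_invariant closed_stable_part)

lemma evolution_average_coboundaries_tendsto:
  assumes "r \<in> coboundaries"
  shows "evolution_average (\<psi>, r) \<longlonglongrightarrow> 0"
proof (rule LIMSEQ_I)
  fix e :: real assume e: "0 < e"
  obtain x where x: "x \<in> stable_part" "dist (\<psi> x - x) r < e / 2"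
    using assms e unfolding coboundaries_def closure_approachable
    by (metis (no_types, lifting) half_gt_zero imageE)
  \<comment> \<open>The approximation error is again stable, so its averages stay below
    \<open>e / 2\<close> for all \<open>t\<close> at once.\<close>
  define d where "d = r - (\<psi> x - x)"
  have d: "d \<in> stable_part" "norm d < e / 2"
    using x assms coboundaries_subset csubspace_stable_part stable_part_invariant
    by (auto simp: d_def dist_norm norm_minus_commute intro!: csubspace_diff)
  obtain N where N: "\<And>t. t \<ge> N \<Longrightarrow> norm (evolution_average (\<psi>, \<psi> x - x) t) < e / 2"
    using LIMSEQ_D[OF evolution_average_coboundary_tendsto[OF x(1)], of "e / 2"] e by auto
  have "norm (evolution_average (\<psi>, r) t - 0) < e" if "t \<ge> N" for t
  proof -
    have "evolution_average (\<psi>, r) t = evolution_average (\<psi>, \<psi> x - x) t + evolution_average (\<psi>, d) t"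
      by (simp add: d_def flip: evolution_average_add)
    then show ?thesis
      using N[OF that] norm_evolution_average_le[OF d(1), of t] d(2)
        norm_triangle_ineq[of "evolution_average (\<psi>, \<psi> x - x) t" "evolution_average (\<psi>, d) t"]
      by simp
  qed
  then show "\<exists>N. \<forall>t\<ge>N. norm (evolution_average (\<psi>, r) t - 0) < e" by blast
qed

section \<open>Fixed vectors and the limit of the averages\<close>

lemma cinner_fixed_coboundaries:
  assumes y: "\<psi> y = y" and r: "r \<in> coboundaries"
  shows "cinner y r = 0"
proof -
  interpret right: bounded_linear "cinner y"
    by (rule bounded_bilinear.bounded_linear_right[OF bounded_bilinear_cinner])
  have "closed {r. cinner y r = 0}"
    by (intro closed_Collect_eq right.continuous_on continuous_intros)
  \<comment> \<open>The adjoint moves \<open>\<psi>\<close> onto \<open>y\<close>, which it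
    fixes.\<close>
  moreover have "cinner y (\<psi> x - x) = 0" for x
    using cadjoint[of y x] cadjoint_fixed[OF y] by (simp add: cinner_diff_right)
  ultimately have "coboundaries \<subseteq> {r. cinner y r = 0}"
    unfolding coboundaries_def by (intro closure_minimal) auto
  with r show ?thesis by blast
qed

text \<open>Orthogonality to \<open>\<psi> q - q\<close> makes its squared norm the difference of
  those of \<open>\<psi> q\<close> and \<open>q\<close>, which is nonpositive because
  \<open>\<psi>\<close> does not increase the norm of \<open>q\<close>.\<close>

lemma orthogonal_coboundaries_imp_fixed:
  assumes q: "q \<in> stable_part" and orth: "\<And>r. r \<in> coboundaries \<Longrightarrow> cinner r q = 0"
  shows "\<psi> q = q"
proof -
  have "\<psi> q - q \<in> coboundaries"
    unfolding coboundaries_def by (rule subsetD[OF closure_subset imageI[OF q]])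
  then have 1: "cinner (\<psi> q) q = cinner q q"
    using orth[of "\<psi> q - q"] by (simp add: cinner_diff_left)
  then have 2: "cinner q (\<psi> q) = cinner q q"
    by (metis cinner_commute)
  have "norm (\<psi> q) \<le> norm q"
    using q unfolding stable_part_def by (auto dest: spec[of _ 1])
  then have "(norm (\<psi> q))\<^sup>2 \<le> (norm q)\<^sup>2"
    by (simp add: power_mono)
  moreover have "(norm (\<psi> q - q))\<^sup>2 = (norm (\<psi> q))\<^sup>2 - (norm q)\<^sup>2"
    by (simp add: norm_sq_cinner cinner_diff_left cinner_diff_right 1 2)
  ultimately have "(norm (\<psi> q - q))\<^sup>2 \<le> 0" by simp
  then show ?thesis by simp
qed

theorem evolution_average_tendsto_projection:
  assumes s: "s \<in> stable_part"
  shows "evolution_average (\<psi>, s) \<longlonglongrightarrow> orthogonal_projection {x. \<psi> x = x} s"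
proof -
  define r where "r = orthogonal_projection coboundaries s"
  define q where "q = s - r"
  have "closed coboundaries" by (simp add: coboundaries_def)
  note proj = orthogonal_projection_works[OF csubspace_coboundaries this, where x = s, folded r_def]
  have r: "r \<in> coboundaries" using proj(1) .
  have "q \<in> stable_part"
    unfolding q_def using s r coboundaries_subset csubspace_stable_part by (blast intro: csubspace_diff)
  then have fixed: "\<psi> q = q"
    using proj(2) by (intro orthogonal_coboundaries_imp_fixed) (auto simp: q_def)
  \<comment> \<open>The case \<open>t = 0\<close> is excluded because the average is 0
    there.\<close>
  have "evolution_average (\<psi>, q) t = q" if "t \<ge> 1" for t
    using that
    by (simp add: evolution_average_def evolution_seq_def funpow_fixed[OF fixed] sum_constant_scaleR)
  then have "evolution_average (\<psi>, q) \<longlonglongrightarrow> q"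
    by (intro tendsto_eventually) (auto simp: eventually_sequentially)
  then have "(\<lambda>t. evolution_average (\<psi>, q) t + evolution_average (\<psi>, r) t) \<longlonglongrightarrow> q + 0"
    using evolution_average_coboundaries_tendsto[OF r] by (rule tendsto_add)
  then have "evolution_average (\<psi>, s) \<longlonglongrightarrow> q"
    by (simp add: q_def flip: evolution_average_add)
  \<comment> \<open>The remainder \<open>s - q\<close> is \<open>r\<close>, to which every fixed
    vector is orthogonal.\<close>
  moreover have "orthogonal_projection {x. \<psi> x = x} s = q"
  proof (rule orthogonal_projection_eqI)
    show "csubspace {x. \<psi> x = x}"
      by (simp add: csubspace_def add scaleC zero)
    show "q \<in> {x. \<psi> x = x}" using fixed by simp
    show "cinner y (s - q) = 0" if "y \<in> {x. \<psi> x = x}" for y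
      using that cinner_fixed_coboundaries[OF _ r] by (simp add: q_def)
  qed
  ultimately show ?thesis by simp
qed

end

theorem theorem2:
  fixes \<psi> :: "'a::chilbert_space \<Rightarrow> 'a" and s :: 'a
  assumes "bounded_clinear \<psi>" and "normal_operator \<psi>"
  shows "(stable_evolution (\<psi>, s) \<longleftrightarrow> mean_ergodic (\<psi>, s)) \<and>
    (stable_evolution (\<psi>, s) \<longrightarrow>
      evolution_average (\<psi>, s) \<longlonglongrightarrow> orthogonal_projection {x. \<psi> x = x} s)"
proof -
  interpret bounded_normal \<psi>
    using assms by unfold_locales
  show ?thesis
    using evolution_average_tendsto_projection mean_ergodic_imp_stable_part
    by (auto simp: stable_evolution_iff mean_ergodic_def convergent_def)
qed

end
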